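(* For each $n$, consider a random model for choosing a labelled square-tiled surface with $n$ squares, i.e. a probability distribution on pairs $(\sigma,\tau)\in S_n\times S_n$, and let $P_n$ be the distribution on the alternating group $A_n$ of the commutator $[\sigma,\tau]=\sigma\tau\sigma^{-1}\tau^{-1}$. Let $U_n$ be the uniform distribution on $A_n$. Assume that $P_n$ is constant on conjugacy classes of $S_n$ and that for some real number $s>1$, $$|A_n|\sum_{\sigma\in A_n}|P_n(\sigma)-U_n(\sigma)|^2=O\left(\frac1{n^s}\right)\quad\text{as } n\to\infty.$$ Then there exists $N\in\mathbb{N}$ such that for all $n>N$, the most probable stratum (for the random surface $S(\sigma,\tau)$) is $\mathcal{H}(n-1)$ if $n$ is odd, and $\mathcal{H}(n-2)$ if $n$ is even.
   Context: $S_n$ is the symmetric group on $\{1,\dots,n\}$. For $\sigma,\tau\in S_n$, $S(\sigma,\tau)$ is the (labelled, not necessarily connected) square-tiled surface built from $n$ axis-parallel unit squares labelled $1,\dots,n$, where the right side of square $j$ is glued by translation to the left side of square $\sigma(j)$ and the top side of square $j$ to the bottom side of square $\tau(j)$. Vertices have total angle $2\pi\ell$ with $\ell\ge1$ an integer; those with $\ell>1$ are cone points. For positive integers $\alpha_1,\dots,\alpha_s$, the stratum $\mathcal{H}(\alpha_1,\dots,\alpha_s)$ is the set of translation surfaces with exactly $s$ cone points, of angles $2\pi(\alpha_1+1),\dots,2\pi(\alpha_s+1)$ (the tuple is unordered; surfaces without cone points form their own stratum). If $[\sigma,\tau]$ has $a_\ell$ cycles of length $\ell$ for each $\ell$, then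 $S(\sigma,\tau)$ has exactly $a_\ell$ vertices of angle $2\pi\ell$; hence, for fixed $n$, the stratum of $S(\sigma,\tau)$ is determined by, and determines, the conjugacy class of $[\sigma,\tau]$ in $S_n$. "The most probable stratum" is the stratum $\mathcal{H}$ such that $\Pr(S(\sigma,\tau)\in\mathcal{H})$ is larger than the corresponding probability for every other stratum. *)

theory Defs
  imports
    "HOL-Probability.Probability"
    "HOL-Algebra.Sym_Groups"
    "HOL-Library.Landau_Symbols"
begin

text \<open>The point \<open>(j, x, y)\<close> is the point with coordinates \<open>(x, y)\<close> in the unit square labelled
  \<open>j\<close>; \<open>x = 1\<close> is the right side and \<open>y = 1\<close> the top side.\<close>

type_synonym square_point = "nat \<times> real \<times> real"

definition squares :: "nat \<Rightarrow> square_point set" where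
  "squares n = {1..n} \<times> {0..1} \<times> {0..1}"

definition gluing :: "nat \<Rightarrow> (nat \<Rightarrow> nat) \<Rightarrow> (nat \<Rightarrow> nat) \<Rightarrow> square_point rel" where
  "gluing n \<sigma> \<tau> =
     {((j, 1, y), (\<sigma> j, 0, y)) | j y. j \<in> {1..n} \<and> y \<in> {0..1}} \<union>
     {((j, x, 1), (\<tau> j, x, 0)) | j x. j \<in> {1..n} \<and> x \<in> {0..1}}"

text \<open>The surface is the quotient of the disjoint union of the squares by the equivalence relation
  generated by the gluing; a point of the surface is an equivalence class.\<close>

definition square_tiled_surface ::
    "nat \<Rightarrow> (nat \<Rightarrow> nat) \<Rightarrow> (nat \<Rightarrow> nat) \<Rightarrow> square_point set set" where
  "square_tiled_surface n \<sigma> \<tau> =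
     squares n // ((gluing n \<sigma> \<tau> \<union> (gluing n \<sigma> \<tau>)\<inverse>)\<^sup>*)"

definition square_tiled_surfaces :: "square_point set set set" where
  "square_tiled_surfaces =
     {square_tiled_surface n \<sigma> \<tau> | n \<sigma> \<tau>.
        n \<ge> 1 \<and> \<sigma> permutes {1..n} \<and> \<tau> permutes {1..n}}"

definition corners :: "square_point set" where
  "corners = UNIV \<times> {0, 1} \<times> {0, 1}"

definition vertices :: "square_point set set \<Rightarrow> square_point set set" where
  "vertices X = {v \<in> X. v \<inter> corners \<noteq> {}}"

text \<open>Every square corner contributes an angle of \<open>pi / 2\<close> to the vertex it is identified with.\<close>

definition total_angle :: "square_point set \<Rightarrow> real" where
  "total_angle v = (\<Sum>c \<in> v \<inter> corners. pi / 2)"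

definition cone_points :: "square_point set set \<Rightarrow> square_point set set" where
  "cone_points X = {v \<in> vertices X. total_angle v > 2 * pi}"

text \<open>The square-tiled surfaces lying in the stratum \<open>H(\<alpha>\<^sub>1, \<dots>, \<alpha>\<^sub>s)\<close>; the unordered tuple of
  positive integers is a multiset, and the empty multiset gives the surfaces without cone points.\<close>

definition stratum :: "nat multiset \<Rightarrow> square_point set set set" where
  "stratum A = {X \<in> square_tiled_surfaces.
     image_mset total_angle (mset_set (cone_points X)) =
     image_mset (\<lambda>a. 2 * pi * (real a + 1)) A}"

definition stratum_prob ::
    "nat \<Rightarrow> ((nat \<Rightarrow> nat) \<times> (nat \<Rightarrow> nat)) pmf \<Rightarrow> nat multiset \<Rightarrow> real" where
  "stratum_prob n D A =
     measure_pmf.prob D {(\<sigma>, \<tau>). square_tiled_surface n \<sigma> \<tau> \<in> stratum A}"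

definition most_probable_stratum ::
    "nat \<Rightarrow> ((nat \<Rightarrow> nat) \<times> (nat \<Rightarrow> nat)) pmf \<Rightarrow> nat multiset \<Rightarrow> bool" where
  "most_probable_stratum n D A \<longleftrightarrow>
     (\<forall>a \<in># A. a > 0) \<and>
     (\<forall>B. (\<forall>b \<in># B. b > 0) \<and> B \<noteq> A \<longrightarrow> stratum_prob n D B < stratum_prob n D A)"

definition perm_commutator :: "(nat \<Rightarrow> nat) \<Rightarrow> (nat \<Rightarrow> nat) \<Rightarrow> (nat \<Rightarrow> nat)" where
  "perm_commutator \<sigma> \<tau> = \<sigma> \<circ> \<tau> \<circ> inv' \<sigma> \<circ> inv' \<tau>"

definition commutator_pmf ::
    "((nat \<Rightarrow> nat) \<times> (nat \<Rightarrow> nat)) pmf \<Rightarrow> (nat \<Rightarrow> nat) pmf" where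
  "commutator_pmf D = map_pmf (\<lambda>(\<sigma>, \<tau>). perm_commutator \<sigma> \<tau>) D"

end

theory Submission
  imports Defs "HOL-Combinatorics.Orbits"
begin

text \<open>
  Going once around a vertex of the surface moves from the bottom left corner of a square to the
  bottom left corner of another square, and this move is the commutator \<open>[\<sigma>, \<tau>]\<close> or its inverse,
  depending on the direction. Vertices therefore correspond to the orbits of \<open>[\<sigma>, \<tau>]\<close>, and an orbit of size \<open>l\<close>
  collects \<open>4 l\<close> corners, that is the angle \<open>2 \<pi> l\<close>. Lying in a given stratum is thus a condition on
  the nontrivial cycle lengths of the commutator (\<open>mem_stratum_iff\<close>).

  Let \<open>T\<close> be the set of even permutations that belong to a stratum, and \<open>t = |T| / |A\<^sub>n|\<close>. By the
  Cauchy-Schwarz inequality the probability of \<open>T\<close> differs from \<open>t\<close> by at most \<open>sqrt (t E)\<close>, where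
  \<open>E\<close> is the quantity assumed to be \<open>O(1 / n\<^sup>s)\<close> (\<open>abs_sum_minus_uniform_le\<close>). When \<open>t\<close> is at most
  of order \<open>1 / n\<close>, this error is \<open>o(1 / n)\<close> because \<open>s > 1\<close>. So it suffices to compare the numbers
  \<open>t\<close> up to \<open>o(1 / n)\<close>.

  For the claimed stratum \<open>T\<close> consists of the \<open>l\<close>-cycles, where \<open>l\<close> is the odd number among
  \<open>n - 1\<close> and \<open>n\<close>. Each of the \<open>n!\<close> lists of \<open>l\<close> distinct points gives such a cycle, and at most \<open>n\<close>
  lists give the same one, so there are at least \<open>(n - 1)!\<close> of them (\<open>card_long_cycles_ge\<close>), hence \<open>t \<ge> 2 / n\<close>. The cycles whose length
  is the even number among \<open>n - 1\<close> and \<open>n\<close> are odd permutations and never occur as commutators.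

  A conjugacy class with \<open>m\<^sub>l\<close> cycles of length \<open>l\<close> for each \<open>l\<close> has \<open>n! / \<Prod>\<^sub>l (l ^ m\<^sub>l m\<^sub>l!)\<close> elements.
  Only a lower bound for the denominator is needed, and it comes from removing one cycle at
  a time: if the cycles of length \<open>l\<close> cover at least \<open>N\<close> points, then the denominator for \<open>n\<close> points
  is at least \<open>N\<close> times the one for the remaining \<open>n - l\<close> points (\<open>card_perms_of_type_step\<close>).
  By induction the denominator is at least \<open>n - 1\<close> (\<open>card_perms_of_type_le\<close>), and one more step shows
  for large \<open>n\<close> that it is at least \<open>3 n / 2\<close> unless the cycle lengths are \<open>n\<close> alone or \<open>n - 1\<close>
  and \<open>1\<close> (\<open>card_perms_of_other_type_le\<close>). Every other stratum therefore has
  \<open>t \<le> 4 / (3 n)\<close>, and the gap of \<open>2 / (3 n)\<close> eventually exceeds the errors.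
\<close>

section \<open>Orbits and cycle types\<close>

definition cycle_type :: "'a set \<Rightarrow> ('a \<Rightarrow> 'a) \<Rightarrow> nat multiset" where
  "cycle_type S c = image_mset card (mset_set (orbit c ` S))"

definition perms_of_type :: "'a set \<Rightarrow> nat multiset \<Rightarrow> ('a \<Rightarrow> 'a) set" where
  "perms_of_type S M = {c. c permutes S \<and> cycle_type S c = M}"

lemma orbit_eq_iff:
  assumes "permutation c"
  shows "orbit c x = orbit c y \<longleftrightarrow> x \<in> orbit c y"
  using assms by (metis cyclic_on_orbit' orbit_cyclic_eq3 permutation_self_in_orbit)

lemma orbit_eq_set_support:
  assumes "permutation c"
  shows "orbit c x = set (support c x)"
  unfolding support_set[OF assms] orbit_altdef_permutation[OF assms] by auto

lemma card_orbit_eq_least_power: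
  assumes "permutation c"
  shows "card (orbit c x) = least_power c x"
  unfolding orbit_eq_set_support[OF assms]
  using distinct_card[OF cycle_of_permutation[OF assms]] by simp

lemma card_orbit_pos:
  assumes "permutation c"
  shows "0 < card (orbit c x)"
  using least_power_of_permutation(2)[OF assms] by (simp add: card_orbit_eq_least_power[OF assms])

lemma fixed_if_card_orbit_eq_1:
  assumes "permutation c" "card (orbit c x) = 1"
  shows "c x = x"
  by (metis assms card_1_singletonE orbit_eq_singleton_iff permutation_self_in_orbit singletonD)

lemma sum_mset_cycle_type:
  assumes "finite S" "c permutes S"
  shows "sum_mset (cycle_type S c) = card S"
proof -
  have perm: "permutation c" using assms permutation_permutes by blast
  have "card S = card (\<Union>(orbit c ` S))"
    using permutes_orbit_subset[OF assms(2)] permutation_self_in_orbit[OF perm]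
    by (intro arg_cong[where f = card]) blast
  also have "\<dots> = sum card (orbit c ` S)"
  proof (rule card_Union_disjoint)
    show "pairwise disjnt (orbit c ` S)"
      unfolding pairwise_def disjnt_def using orbit_eq_iff[OF perm] by blast
    show "\<And>A. A \<in> orbit c ` S \<Longrightarrow> finite A"
      using finite_orbit permutation_self_in_orbit[OF perm] by fast
  qed
  finally show ?thesis by (simp add: cycle_type_def sum_unfold_sum_mset)
qed

lemma in_cycle_type_iff:
  assumes "finite S"
  shows "l \<in># cycle_type S c \<longleftrightarrow> (\<exists>x\<in>S. card (orbit c x) = l)"
  using assms by (auto simp: cycle_type_def)

lemma cycle_type_remove_orbit:
  assumes S: "finite S" and c: "c permutes S" and x: "x \<in> S"
  defines "R \<equiv> S - orbit c x"
  shows "cycle_type R (perm_restrict c R) = cycle_type S c - {#card (orbit c x)#}"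
proof -
  have perm: "permutation c" using assms permutation_permutes by blast
  have stay: "orbit c y \<subseteq> R" if "y \<in> R" for y
  proof
    fix z assume z: "z \<in> orbit c y"
    have "orbit c z \<noteq> orbit c x"
      using that z orbit_eq_iff[OF perm, of z y] orbit_eq_iff[OF perm, of y x] by (simp add: R_def)
    thus "z \<in> R"
      using that z permutes_orbit_subset[OF c, of y] orbit_eq_iff[OF perm, of z x]
      by (auto simp: R_def)
  qed
  have "orbit (perm_restrict c R) y = orbit c y" if "y \<in> R" for y
    using stay[OF that] permutation_self_in_orbit[OF perm]
    by (intro orbit_cong) (auto simp: perm_restrict_simps)
  hence "orbit (perm_restrict c R) ` R = orbit c ` R" by simp
  also have "\<dots> = orbit c ` S - {orbit c x}"
    unfolding R_def using orbit_eq_iff[OF perm] by auto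
  finally have "mset_set (orbit (perm_restrict c R) ` R) = mset_set (orbit c ` S) - {#orbit c x#}"
    using S x by (simp add: mset_set_Diff)
  moreover have "orbit c x \<in># mset_set (orbit c ` S)" using S x by simp
  ultimately show ?thesis
    unfolding cycle_type_def by (simp add: image_mset_Diff)
qed

lemma card_points_of_cycle_length:
  assumes S: "finite S" and c: "c permutes S" and l: "l \<in># cycle_type S c"
  shows "l \<le> card {x \<in> S. card (orbit c x) = l}"
proof -
  have perm: "permutation c" using S c permutation_permutes by blast
  obtain x where x: "x \<in> S" "card (orbit c x) = l" using l in_cycle_type_iff[OF S] by auto
  have "orbit c x \<subseteq> {x \<in> S. card (orbit c x) = l}"
  proof
    fix y assume "y \<in> orbit c x"
    thus "y \<in> {x \<in> S. card (orbit c x) = l}"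
      using x permutes_orbit_subset[OF c x(1)] orbit_eq_iff[OF perm, of y x] by auto
  qed
  from card_mono[OF _ this] show ?thesis using S x by simp
qed

section \<open>Few permutations have a given cycle type\<close>

lemma card_distinct_lists_times_fact:
  assumes "finite S" "l \<le> card S"
  shows "card {xs. length xs = l \<and> distinct xs \<and> set xs \<subseteq> S} * fact (card S - l) = fact (card S)"
proof -
  have "(fact (card S) :: nat) = \<Prod>{card S - l + 1..card S} * fact (card S - l)"
    using fact_div_fact[of "card S - l" "card S"] assms(2)
    by (metis diff_le_self dvd_div_mult_self fact_dvd)
  thus ?thesis using card_lists_distinct_length_eq[OF assms(1,2)] by simp
qed

text \<open>A cycle through \<open>x\<close>, read off starting from \<open>x\<close>, determines \<open>x\<close> and the action of \<open>c\<close> on that cycle;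
  what remains of \<open>c\<close> is its restriction to the other points.\<close>

lemma inj_on_split_off_cycle:
  assumes S: "finite S" and l: "0 < l"
  shows "inj_on (\<lambda>(c, x). (support c x, perm_restrict c (S - orbit c x)))
    (SIGMA c:perms_of_type S M. {x \<in> S. card (orbit c x) = l})"
proof (rule inj_onI, clarsimp simp: perms_of_type_def)
  fix c x d y
  assume c: "c permutes S" and d: "d permutes S"
    and l: "l = card (orbit c x)" and ly: "card (orbit d y) = card (orbit c x)"
    and sup: "support c x = support d y"
    and res: "perm_restrict c (S - orbit c x) = perm_restrict d (S - orbit d y)"
  have pc: "permutation c" and pd: "permutation d" using S c d permutation_permutes by blast+
  have lc: "least_power c x = l" and ld: "least_power d y = l"
    using l ly card_orbit_eq_least_power[OF pc] card_orbit_eq_least_power[OF pd] by auto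
  have l0: "0 < l" using card_orbit_pos[OF pc] l by simp
  have eq: "(c ^^ i) x = (d ^^ i) y" if "i < l" for i
    using arg_cong[OF sup, of "\<lambda>xs. xs ! i"] that by (simp add: lc ld)
  have xy: "x = y" using eq[OF l0] by simp
  have orb: "orbit c x = orbit d y"
    using sup orbit_eq_set_support[OF pc] orbit_eq_set_support[OF pd] by metis
  have pow: "(c ^^ l) x = x" "(d ^^ l) y = y"
    using least_power_of_permutation(1)[OF pc, of x] least_power_of_permutation(1)[OF pd, of y]
    by (simp_all add: lc ld)
  \<comment> \<open>Both iterates return to the starting point at \<open>i = l\<close>, one step after the end of the two lists.\<close>
  have eq': "(c ^^ i) x = (d ^^ i) y" if "i \<le> l" for i
    using that eq pow xy by (cases "i = l") auto
  have "c z = d z" for z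
  proof (cases "z \<in> orbit c x")
    case True
    then obtain i where i: "i < l" "z = (c ^^ i) x"
      unfolding orbit_eq_set_support[OF pc] by (auto simp: lc)
    have "c z = (c ^^ Suc i) x" using i by simp
    also have "\<dots> = (d ^^ Suc i) y" using i by (intro eq') simp
    also have "\<dots> = d z" using i eq[of i] by simp
    finally show ?thesis .
  next
    case False
    show ?thesis
    proof (cases "z \<in> S")
      case True
      with False have "z \<in> S - orbit c x" "z \<in> S - orbit d y" using orb by auto
      thus ?thesis using fun_cong[OF res, of z] by (simp add: perm_restrict_simps)
    next
      case False
      thus ?thesis using c d by (simp add: permutes_not_in)
    qed
  qed
  with xy show "c = d \<and> x = y" by auto
qed

lemma finite_perms_of_type: "finite S \<Longrightarrow> finite (perms_of_type S M)"
  unfolding perms_of_type_def by (rule finite_subset[OF _ finite_permutations[of S]]) auto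

lemma card_perms_of_type_le_fact:
  assumes "finite S"
  shows "card (perms_of_type S M) \<le> fact (card S)"
  unfolding card_permutations[OF refl assms, symmetric] perms_of_type_def
  using finite_permutations[OF assms] by (intro card_mono) auto

text \<open>Count the pairs of a permutation \<open>c\<close> of type \<open>M\<close> and a point \<open>x\<close> on an \<open>l\<close>-cycle of \<open>c\<close>. Each \<open>c\<close>
  contributes at least \<open>N\<close> points, while splitting off the cycle of \<open>x\<close> leaves one of the
  \<open>|S|! / (|S| - l)!\<close> lists of \<open>l\<close> distinct points and a permutation of the other \<open>|S| - l\<close> points. The
  factor \<open>z\<close> plays the role of the order of the centralizer of the latter, and \<open>N * z\<close> is the
  resulting bound for \<open>S\<close>.\<close>

lemma card_perms_of_type_step:
  fixes S :: "'a set"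
  assumes S: "finite S" and l: "0 < l" "l \<le> card S"
    and many: "\<And>c. c \<in> perms_of_type S M \<Longrightarrow> N \<le> card {x \<in> S. card (orbit c x) = l}"
    and IH: "\<And>R :: 'a set. finite R \<Longrightarrow> card R = card S - l \<Longrightarrow>
      card (perms_of_type R (M - {#l#})) * z \<le> fact (card S - l)"
  shows "card (perms_of_type S M) * (N * z) \<le> fact (card S)"
proof -
  define L where "L = {xs. length xs = l \<and> distinct xs \<and> set xs \<subseteq> S}"
  define X where "X = (SIGMA c:perms_of_type S M. {x \<in> S. card (orbit c x) = l})"
  define Y where "Y = (SIGMA xs:L. perms_of_type (S - set xs) (M - {#l#}))"
  have fin: "finite (perms_of_type R K)" if "finite R" for R :: "'a set" and K
    using that by (rule finite_perms_of_type)
  have finL: "finite L"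
    unfolding L_def by (rule finite_subset[OF _ finite_lists_length_eq[OF S, of l]]) auto
  have "card (perms_of_type S M) * N \<le> (\<Sum>c\<in>perms_of_type S M. card {x \<in> S. card (orbit c x) = l})"
    using sum_bounded_below[of "perms_of_type S M" N "\<lambda>c. card {x \<in> S. card (orbit c x) = l}"] many
    by simp
  also have "\<dots> = card X"
    unfolding X_def using S fin by (subst card_SigmaI) auto
  also have "\<dots> \<le> card Y"
  proof (rule card_inj_on_le)
    let ?f = "\<lambda>(c, x). (support c x, perm_restrict c (S - orbit c x))"
    show "inj_on ?f X" unfolding X_def by (rule inj_on_split_off_cycle[OF S l(1)])
    show "?f ` X \<subseteq> Y"
    proof (rule image_subsetI)
      fix p assume "p \<in> X"
      then obtain c x where p: "p = (c, x)" and c: "c permutes S" and M: "cycle_type S c = M"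
        and x: "x \<in> S" "card (orbit c x) = l"
        unfolding X_def perms_of_type_def by auto
      have perm: "permutation c" using S c permutation_permutes by blast
      have set: "set (support c x) = orbit c x" by (rule orbit_eq_set_support[OF perm, symmetric])
      have "support c x \<in> L"
        unfolding L_def using cycle_of_permutation[OF perm, of x] x
          permutes_orbit_subset[OF c x(1)] card_orbit_eq_least_power[OF perm, of x] set by auto
      moreover have "perm_restrict c (S - orbit c x) permutes (S - orbit c x)"
        by (intro perm_restrict_diff_cyclic c cyclic_on_orbit'[OF perm])
      hence "perm_restrict c (S - orbit c x) \<in> perms_of_type (S - orbit c x) (M - {#l#})"
        unfolding perms_of_type_def using cycle_type_remove_orbit[OF S c x(1)] x M by simp
      ultimately show "?f p \<in> Y"
        unfolding p Y_def by (simp del: set_map add: set)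
    qed
    show "finite Y" unfolding Y_def using finL S fin by auto
  qed
  also have "card Y = (\<Sum>xs\<in>L. card (perms_of_type (S - set xs) (M - {#l#})))"
    unfolding Y_def using finL S fin by (subst card_SigmaI) auto
  finally have "card (perms_of_type S M) * N * z
      \<le> (\<Sum>xs\<in>L. card (perms_of_type (S - set xs) (M - {#l#})) * z)"
    by (simp add: sum_distrib_right[symmetric])
  also have "\<dots> \<le> (\<Sum>xs\<in>L. fact (card S - l))"
  proof (rule sum_mono)
    fix xs assume "xs \<in> L"
    hence "card (S - set xs) = card S - l"
      unfolding L_def using S by (auto simp: card_Diff_subset distinct_card)
    thus "card (perms_of_type (S - set xs) (M - {#l#})) * z \<le> fact (card S - l)"
      using S by (intro IH) auto
  qed
  also have "\<dots> = card L * fact (card S - l)" by simp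
  also have "\<dots> = fact (card S)"
    unfolding L_def by (rule card_distinct_lists_times_fact[OF S l(2)])
  finally show ?thesis by (simp add: mult.assoc)
qed

lemma card_points_if_all_fixed:
  assumes S: "finite S" and "c permutes S" and ones: "\<And>l. l \<in># cycle_type S c \<Longrightarrow> l < 2"
  shows "card {x \<in> S. card (orbit c x) = 1} = card S"
proof -
  have perm: "permutation c" using assms permutation_permutes by blast
  have "card (orbit c x) = 1" if "x \<in> S" for x
    using ones[of "card (orbit c x)"] card_orbit_pos[OF perm, of x] that in_cycle_type_iff[OF S]
    by force
  hence "{x \<in> S. card (orbit c x) = 1} = S" by auto
  thus ?thesis by simp
qed

text \<open>The estimates that turn the factors found by splitting off a cycle into bounds linear in the
  number of points.\<close>

lemma mult_ge_add:
  fixes a b :: nat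
  assumes "2 \<le> a" "2 \<le> b"
  shows "2 * (a + b) \<le> a * b + 4" "a + b \<le> a * b"
proof -
  obtain a' b' where ab: "a = 2 + a'" "b = 2 + b'" using assms by (metis le_add_diff_inverse)
  show "2 * (a + b) \<le> a * b + 4" "a + b \<le> a * b" unfolding ab by (simp_all add: algebra_simps)
qed

text \<open>The first pass of the recursion. The value \<open>|S| - 1\<close> is attained by the cycle lengths
  \<open>|S| - 1\<close> and \<open>1\<close> when \<open>|S| \<ge> 3\<close>. The factor 2 matters for two points, where \<open>|S| - 1\<close> would lose the fact that
  both permutations of two points have a centralizer of order 2, and the induction
  would break down for types with a long cycle and two remaining points.\<close>

lemma card_perms_of_type_le:
  fixes S :: "'a set"
  assumes "finite S" "2 \<le> card S"
  shows "card (perms_of_type S M) * max 2 (card S - 1) \<le> fact (card S)"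
  using assms
proof (induction "card S" arbitrary: S M rule: less_induct)
  case less
  show ?case
  proof (cases "perms_of_type S M = {}")
    case False
    then obtain c where c: "c permutes S" "cycle_type S c = M" by (auto simp: perms_of_type_def)
    note S = \<open>finite S\<close>
    have perm: "permutation c" using S c permutation_permutes by blast
    show ?thesis
    proof (cases "\<exists>l\<in>#M. 2 \<le> l")
      case True
      then obtain l where l: "l \<in># M" "2 \<le> l" by auto
      have le: "l \<le> card S"
        using sum_mset_cycle_type[OF S c(1)] l(1) c(2) by (metis sum_mset.remove le_add1)
      \<comment> \<open>With at most one point left, only the trivial bound is available, but then \<open>l\<close> alone suffices.\<close>
      define z where "z = (if card S - l < 2 then 1 else max 2 (card S - l - 1))"
      have "card (perms_of_type S M) * (l * z) \<le> fact (card S)"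
      proof (rule card_perms_of_type_step[OF S _ le])
        show "0 < l" using l by simp
        show "l \<le> card {x \<in> S. card (orbit c x) = l}" if "c \<in> perms_of_type S M" for c
          using that l S by (intro card_points_of_cycle_length) (auto simp: perms_of_type_def)
        show "card (perms_of_type R (M - {#l#})) * z \<le> fact (card S - l)"
          if R: "finite R" "card R = card S - l" for R :: "'a set"
        proof (cases "card S - l < 2")
          case True
          thus ?thesis using card_perms_of_type_le_fact[OF R(1), of "M - {#l#}"] R(2)
            by (simp add: z_def)
        next
          case False
          thus ?thesis using less.hyps[of R "M - {#l#}"] R l le by (simp add: z_def)
        qed
      qed
      moreover have "max 2 (card S - 1) \<le> l * z"
      proof (cases "card S - l < 2")
        case True
        thus ?thesis using l less.prems le by (auto simp: z_def)
      next
        case False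
        have "l + z \<le> l * z" using l False by (intro mult_ge_add) (auto simp: z_def)
        moreover have "card S - 1 \<le> l + z" "2 \<le> l + z" using False l by (auto simp: z_def)
        ultimately show ?thesis by simp
      qed
      ultimately show ?thesis by (meson le_trans mult_le_mono2)
    next
      case False
      have "card (perms_of_type S M) * (card S * 1) \<le> fact (card S)"
      proof (rule card_perms_of_type_step[OF S, of 1])
        show "card S \<le> card {x \<in> S. card (orbit c x) = 1}" if "c \<in> perms_of_type S M" for c
          using that False card_points_if_all_fixed[OF S, of c]
          by (auto simp: perms_of_type_def not_le)
        show "card (perms_of_type R (M - {#1#})) * 1 \<le> fact (card S - 1)"
          if "finite R" "card R = card S - 1" for R :: "'a set"
          using card_perms_of_type_le_fact[OF that(1), of "M - {#1#}"] that(2) by simp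
      qed (use less.prems in auto)
      moreover have "max 2 (card S - 1) \<le> card S * 1" using less.prems by auto
      ultimately show ?thesis by (meson le_trans mult_le_mono2)
    qed
  qed simp
qed

text \<open>Excluding the two types leaves at least two points outside any chosen nontrivial cycle, so the
  remaining points contribute a second factor: the bound is a product of two numbers, both at least
  2, whose sum is at least \<open>|S| - 1\<close>. Such a product is at least \<open>2 (|S| - 3)\<close>, which is at least
  \<open>3 |S| / 2\<close> as soon as \<open>|S| \<ge> 12\<close>.\<close>

lemma card_perms_of_other_type_le:
  fixes S :: "'a set"
  assumes S: "finite S" and n: "12 \<le> card S"
    and M: "M \<noteq> {#card S#}" "M \<noteq> {#card S - 1, 1#}"
  shows "card (perms_of_type S M) * (3 * card S) \<le> 2 * fact (card S)"
proof (cases "perms_of_type S M = {}")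
  case False
  then obtain c where c: "c permutes S" "cycle_type S c = M" by (auto simp: perms_of_type_def)
  have perm: "permutation c" using S c permutation_permutes by blast
  have sum: "sum_mset M = card S" using sum_mset_cycle_type[OF S c(1)] c(2) by simp
  have pos: "0 \<notin># M" using in_cycle_type_iff[OF S, of 0 c] c(2) card_orbit_pos[OF perm]
    by (metis less_irrefl)
  have bound: "card (perms_of_type R K) * max 2 (card R - 1) \<le> fact (card R)"
    if "finite R" "2 \<le> card R" for R :: "'a set" and K
    using that by (rule card_perms_of_type_le)
  \<comment> \<open>The first factor counts points on the cycles of the chosen length, the second one comes from the rest.\<close>
  obtain a b where ab: "2 \<le> a" "2 \<le> b" "card S \<le> a + b + 1"
    and le: "card (perms_of_type S M) * (a * b) \<le> fact (card S)"
  proof (cases "\<exists>l\<in>#M. 2 \<le> l")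
    case True
    then obtain l where l: "l \<in># M" "2 \<le> l" by auto
    define K where "K = M - {#l#}"
    have MK: "M = add_mset l K" using l by (simp add: K_def)
    have sumK: "sum_mset K + l = card S" using sum MK by simp
    have "sum_mset K \<noteq> 0"
    proof
      assume "sum_mset K = 0"
      hence "K = {#}" using pos MK by (cases K) auto
      thus False using M(1) MK sumK by simp
    qed
    moreover have "sum_mset K \<noteq> 1"
    proof
      assume *: "sum_mset K = 1"
      then obtain a K' where K': "K = add_mset a K'" by (cases K) auto
      have "a \<noteq> 0" using pos MK K' by auto
      moreover have "a + sum_mset K' = 1" using * K' by simp
      ultimately have "a = 1" "sum_mset K' = 0" by linarith+
      hence "K' = {#}" using pos MK K' by (cases K') auto
      thus False using M(2) MK sumK K' \<open>a = 1\<close> * by simp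
    qed
    ultimately have "2 \<le> sum_mset K" by linarith
    hence r: "2 \<le> card S - l" "l \<le> card S" using sumK by linarith+
    show thesis
    proof (rule that[of l "max 2 (card S - l - 1)"])
      show "card (perms_of_type S M) * (l * max 2 (card S - l - 1)) \<le> fact (card S)"
      proof (rule card_perms_of_type_step[OF S _ r(2)])
        show "l \<le> card {x \<in> S. card (orbit c x) = l}" if "c \<in> perms_of_type S M" for c
          using that l S by (intro card_points_of_cycle_length) (auto simp: perms_of_type_def)
        show "card (perms_of_type R (M - {#l#})) * max 2 (card S - l - 1) \<le> fact (card S - l)"
          if "finite R" "card R = card S - l" for R :: "'a set"
          using bound[of R "M - {#l#}"] that r by simp
      qed (use l in auto)
    qed (use l r in auto)
  next
    case False
    show thesis
    proof (rule that[of "card S" "max 2 (card S - 1 - 1)"])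
      show "card (perms_of_type S M) * (card S * max 2 (card S - 1 - 1)) \<le> fact (card S)"
      proof (rule card_perms_of_type_step[OF S, of 1])
        show "card S \<le> card {x \<in> S. card (orbit c x) = 1}" if "c \<in> perms_of_type S M" for c
          using that False card_points_if_all_fixed[OF S, of c]
          by (auto simp: perms_of_type_def not_le)
        show "card (perms_of_type R (M - {#1#})) * max 2 (card S - 1 - 1) \<le> fact (card S - 1)"
          if "finite R" "card R = card S - 1" for R :: "'a set"
          using bound[of R "M - {#1#}"] that n by simp
      qed (use n in auto)
    qed (use n in auto)
  qed
  define p where "p = a * b"
  have "2 * (a + b) \<le> p + 4" unfolding p_def by (rule mult_ge_add(1)[OF ab(1,2)])
  hence "3 * card S \<le> 2 * p" using ab(3) n by simp
  hence "3 * card S \<le> 2 * (a * b)" by (simp add: p_def)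
  hence "card (perms_of_type S M) * (3 * card S) \<le> card (perms_of_type S M) * (2 * (a * b))"
    by (rule mult_le_mono2)
  also have "\<dots> \<le> 2 * fact (card S)" using le by simp
  finally show ?thesis .
qed simp

section \<open>Cone types and the parity of long cycles\<close>

text \<open>Trivial cycles correspond to vertices of angle \<open>2 \<pi>\<close>, which are invisible in the stratum; only the
  longer ones are recorded.\<close>

definition cone_type :: "'a set \<Rightarrow> ('a \<Rightarrow> 'a) \<Rightarrow> nat multiset" where
  "cone_type S c = filter_mset (\<lambda>l. 1 < l) (cycle_type S c)"

text \<open>The number of fixed points is recovered from the total number of points, so for fixed \<open>S\<close> the cone
  type and the cycle type carry the same information.\<close>

lemma cycle_type_eq_cone_type:
  assumes "finite S" "c permutes S"
  shows "cycle_type S c =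
    cone_type S c + replicate_mset (card S - sum_mset (cone_type S c)) 1"
proof -
  have perm: "permutation c" using assms permutation_permutes by blast
  define F where "F = filter_mset (\<lambda>l. \<not> 1 < l) (cycle_type S c)"
  have split: "cycle_type S c = cone_type S c + F"
    unfolding F_def cone_type_def by (rule multiset_partition)
  have "l = 1" if "l \<in># F" for l
  proof -
    have l: "l \<in># cycle_type S c" "\<not> 1 < l" using that by (auto simp: F_def)
    obtain x where "card (orbit c x) = l" using l(1) in_cycle_type_iff[OF assms(1)] by blast
    thus ?thesis using l(2) card_orbit_pos[OF perm, of x] by simp
  qed
  hence "F = replicate_mset (size F) 1"
    by (intro set_mset_subset_singletonD) auto
  moreover from this have "sum_mset F = size F"
    by (metis mult.right_neutral sum_mset_replicate_mset of_nat_id)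
  moreover have "sum_mset (cone_type S c) + sum_mset F = card S"
    using sum_mset_cycle_type[OF assms] split by simp
  ultimately show ?thesis using split by (metis add_diff_cancel_left')
qed

lemma evenperm_cycle_of_list:
  assumes "distinct xs" "xs \<noteq> []"
  shows "evenperm (cycle_of_list xs) \<longleftrightarrow> odd (length xs)"
  using assms
proof (induction xs rule: cycle_of_list.induct)
  case (1 i j cs)
  thus ?case
    by (simp add: evenperm_comp permutation_swap_id permutation_of_cycle evenperm_swap
        del: o_apply cycle_of_list.simps(2,3))
qed auto

text \<open>Every point outside the orbit of size \<open>l\<close> is fixed, so \<open>c\<close> is the cycle through that orbit.\<close>

lemma evenperm_if_single_cone:
  assumes S: "finite S" and c: "c permutes S" and cone: "cone_type S c = {#l#}"
  shows "evenperm c \<longleftrightarrow> odd l"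
proof -
  have perm: "permutation c" using S c permutation_permutes by blast
  define Os where "Os = {A \<in> orbit c ` S. 1 < card A}"
  have "cone_type S c = image_mset card (mset_set Os)"
    unfolding cone_type_def cycle_type_def Os_def by (simp add: filter_mset_image_mset S)
  hence img: "image_mset card (mset_set Os) = {#l#}" using cone by simp
  have "card Os = 1" using arg_cong[OF img, of size] by simp
  then obtain A where Os: "Os = {A}" by (rule card_1_singletonE)
  hence A: "card A = l" using img by simp
  have "A \<in> Os" by (simp add: Os)
  then obtain x where x: "x \<in> S" "A = orbit c x" unfolding Os_def by blast
  have l: "length (support c x) = l" using A x card_orbit_eq_least_power[OF perm, of x] by simp
  have "c y = cycle_of_list (support c x) y" for y
  proof (cases "y \<in> orbit c x")
    case True
    thus ?thesis using cycle_restrict[OF perm, of y x] orbit_eq_set_support[OF perm, of x] by simp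
  next
    case False
    have "c y = y"
    proof (cases "y \<in> S")
      case True
      have "orbit c y \<noteq> A" using False x orbit_eq_iff[OF perm] by auto
      hence "\<not> 1 < card (orbit c y)" using Os True unfolding Os_def by blast
      hence "card (orbit c y) = 1" using card_orbit_pos[OF perm, of y] by simp
      thus ?thesis by (rule fixed_if_card_orbit_eq_1[OF perm])
    qed (use c permutes_not_in in fast)
    thus ?thesis
      using False id_outside_supp[of y "support c x"] orbit_eq_set_support[OF perm, of x] by simp
  qed
  hence "c = cycle_of_list (support c x)" by auto
  moreover have "support c x \<noteq> []"
    using least_power_of_permutation(2)[OF perm, of x] by simp
  ultimately show ?thesis
    using evenperm_cycle_of_list[OF cycle_of_permutation[OF perm], of x] l by metis
qed

lemma funpow_cycle_of_list:
  assumes "distinct xs" "i < length xs"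
  shows "(cycle_of_list xs ^^ i) (hd xs) = xs ! i"
proof -
  have "xs \<noteq> []" using assms by auto
  hence "(cycle_of_list xs ^^ i) (hd xs) = map (cycle_of_list xs ^^ i) xs ! 0"
    by (simp add: hd_conv_nth)
  also have "\<dots> = rotate i xs ! 0" by (simp add: cyclic_rotation[OF assms(1)])
  also have "\<dots> = xs ! i" using assms \<open>xs \<noteq> []\<close> by (simp add: nth_rotate)
  finally show ?thesis .
qed

lemma cone_type_cycle_of_list:
  assumes S: "finite S" "set xs \<subseteq> S" and xs: "distinct xs" "2 \<le> length xs"
  shows "cone_type S (cycle_of_list xs) = {#length xs#}"
proof -
  let ?c = "cycle_of_list xs"
  have perm: "permutation ?c" by (rule permutation_of_cycle)
  have ne: "xs \<noteq> []" using xs by auto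
  have "orbit ?c (hd xs) \<subseteq> set xs"
    by (intro permutes_orbit_subset cycle_permutes) (use ne in simp)
  moreover have "xs ! i \<in> orbit ?c (hd xs)" if "i < length xs" for i
    unfolding orbit_altdef_permutation[OF perm] funpow_cycle_of_list[OF xs(1) that, symmetric]
    by blast
  ultimately have hd: "orbit ?c (hd xs) = set xs" by (auto simp: in_set_conv_nth)
  have "orbit ?c y = (if y \<in> set xs then set xs else {y})" for y
    using hd orbit_eq_iff[OF perm, of y "hd xs"] id_outside_supp[of y xs]
      orbit_eq_singleton_iff[of ?c y] by auto
  hence "{A \<in> orbit ?c ` S. 1 < card A} = {set xs}"
    using xs S(2) hd_in_set[OF ne] by (auto simp: distinct_card image_iff intro: hd_in_set)
  thus ?thesis
    using S xs unfolding cone_type_def cycle_type_def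
    by (simp add: filter_mset_image_mset distinct_card)
qed

text \<open>A list of \<open>l\<close> distinct points is recovered from its cyclic permutation and its head, so there are
  at most \<open>|S|\<close> lists for each cycle. For the two admitted values of \<open>l\<close> there are \<open>|S|!\<close> lists,
  since at most one point is left out.\<close>

lemma card_long_cycles_ge:
  assumes S: "finite S" and l: "2 \<le> l" "card S - 1 \<le> l" "l \<le> card S"
  shows "fact (card S) \<le> card S * card {c. c permutes S \<and> cone_type S c = {#l#}}"
proof -
  define L where "L = {xs. length xs = l \<and> distinct xs \<and> set xs \<subseteq> S}"
  define C where "C = {c. c permutes S \<and> cone_type S c = {#l#}}"
  have finC: "finite C"
    unfolding C_def by (rule finite_subset[OF _ finite_permutations[OF S]]) auto
  have "card S - l = 0 \<or> card S - l = 1" using l by auto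
  hence "fact (card S - l) = (1 :: nat)" by auto
  hence "fact (card S) = card L"
    unfolding L_def using card_distinct_lists_times_fact[OF S l(3)] by simp
  also have "\<dots> \<le> card (C \<times> S)"
  proof (rule card_inj_on_le)
    let ?f = "\<lambda>xs. (cycle_of_list xs, hd xs)"
    show "inj_on ?f L"
    proof (rule inj_onI)
      fix xs ys assume xs: "xs \<in> L" and ys: "ys \<in> L" and eq: "?f xs = ?f ys"
      show "xs = ys"
      proof (rule nth_equalityI)
        show len: "length xs = length ys" using xs ys by (simp add: L_def)
        show "xs ! i = ys ! i" if "i < length xs" for i
          using that funpow_cycle_of_list[of xs i] funpow_cycle_of_list[of ys i] eq xs ys len
          by (simp add: L_def)
      qed
    qed
    show "?f ` L \<subseteq> C \<times> S"
    proof (rule image_subsetI)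
      fix xs assume xs: "xs \<in> L"
      have "cycle_of_list xs permutes S"
        using cycle_permutes[of xs] xs permutes_subset by (auto simp: L_def)
      moreover have "cone_type S (cycle_of_list xs) = {#l#}"
        using cone_type_cycle_of_list[OF S, of xs] xs l by (simp add: L_def)
      moreover have "hd xs \<in> S" using xs l by (cases xs) (auto simp: L_def)
      ultimately show "?f xs \<in> C \<times> S" by (simp add: C_def)
    qed
    show "finite (C \<times> S)" using finC S by simp
  qed
  finally show ?thesis by (simp add: card_cartesian_product C_def mult.commute)
qed

text \<open>A cone type determines the cycle type, so this is the bound for cycle types; the two excluded
  cone types are those of the cycle types \<open>{n}\<close> and \<open>{n - 1, 1}\<close>.\<close>

lemma card_other_cone_types_le:
  assumes S: "finite S" and n: "12 \<le> card S"
    and K: "K \<noteq> {#card S#}" "K \<noteq> {#card S - 1#}"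
  shows "card {c. c permutes S \<and> cone_type S c = K} * (3 * card S) \<le> 2 * fact (card S)"
proof -
  define M where "M = K + replicate_mset (card S - sum_mset K) 1"
  define C where "C = {c. c permutes S \<and> cone_type S c = K}"
  show ?thesis
  proof (cases "C = {}")
    case False
    have sub: "C \<subseteq> perms_of_type S M"
      unfolding C_def perms_of_type_def M_def using cycle_type_eq_cone_type[OF S] by auto
    obtain c where "c permutes S" "cone_type S c = K" using False unfolding C_def by auto
    hence filt: "filter_mset (\<lambda>l. 1 < l) M = K"
      using cycle_type_eq_cone_type[OF S, of c] unfolding M_def cone_type_def by metis
    have "card C * (3 * card S) \<le> card (perms_of_type S M) * (3 * card S)"
      using card_mono[OF finite_perms_of_type[OF S] sub] by (rule mult_le_mono1)
    also have "\<dots> \<le> 2 * fact (card S)"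
    proof (rule card_perms_of_other_type_le[OF S n])
      show "M \<noteq> {#card S#}" using filt K(1) n by auto
      have "1 < card S - 1" using n by simp
      thus "M \<noteq> {#card S - 1, 1#}" using filt K(2) by auto
    qed
    finally show ?thesis by (simp add: C_def)
  next
    case True
    hence "card C = 0" by simp
    thus ?thesis unfolding C_def by simp
  qed
qed

section \<open>Vertices of a square-tiled surface\<close>

definition corner_rel :: "nat \<Rightarrow> (nat \<Rightarrow> nat) \<Rightarrow> (nat \<Rightarrow> nat) \<Rightarrow> square_point rel" where
  "corner_rel n \<sigma> \<tau> = (gluing n \<sigma> \<tau> \<union> (gluing n \<sigma> \<tau>)\<inverse>)\<^sup>*"

text \<open>The square whose bottom left corner is reached from a corner by gluing at most one horizontal and
  one vertical side. For a top right corner there are two ways to get there, ending in \<open>\<sigma> (\<tau> j)\<close>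
  or \<open>\<tau> (\<sigma> j)\<close>; the first one is chosen, and the commutator maps the second to the first.\<close>

definition base_square :: "(nat \<Rightarrow> nat) \<Rightarrow> (nat \<Rightarrow> nat) \<Rightarrow> square_point \<Rightarrow> nat" where
  "base_square \<sigma> \<tau> = (\<lambda>(j, x, y). (if x = 1 then \<sigma> else id) ((if y = 1 then \<tau> else id) j))"

definition square_corners :: "nat \<Rightarrow> square_point set" where
  "square_corners n = {1..n} \<times> {0, 1} \<times> {0, 1}"

definition vertex_of :: "nat \<Rightarrow> (nat \<Rightarrow> nat) \<Rightarrow> (nat \<Rightarrow> nat) \<Rightarrow> nat set \<Rightarrow> square_point set" where
  "vertex_of n \<sigma> \<tau> A = {p \<in> square_corners n. base_square \<sigma> \<tau> p \<in> A}"

context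
  fixes n :: nat and \<sigma> \<tau> :: "nat \<Rightarrow> nat"
  assumes \<sigma>: "\<sigma> permutes {1..n}" and \<tau>: "\<tau> permutes {1..n}"
begin

lemma commutator_permutes: "perm_commutator \<sigma> \<tau> permutes {1..n}"
  unfolding perm_commutator_def by (intro permutes_compose permutes_inv \<sigma> \<tau>)

lemma permutation_commutator: "permutation (perm_commutator \<sigma> \<tau>)"
  using commutator_permutes permutation_permutes by blast

lemma commutator_apply: "perm_commutator \<sigma> \<tau> (\<tau> (\<sigma> j)) = \<sigma> (\<tau> j)"
  unfolding perm_commutator_def
  by (simp add: permutes_inverses(2)[OF \<sigma>] permutes_inverses(2)[OF \<tau>])

lemma perm_mem: "j \<in> {1..n} \<Longrightarrow> \<sigma> j \<in> {1..n}" "j \<in> {1..n} \<Longrightarrow> \<tau> j \<in> {1..n}"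
  using permutes_in_image[OF \<sigma>] permutes_in_image[OF \<tau>] by blast+

lemma sym_corner_rel: "sym (corner_rel n \<sigma> \<tau>)"
  unfolding corner_rel_def by (intro sym_rtrancl sym_Un_converse)

lemma trans_corner_rel: "trans (corner_rel n \<sigma> \<tau>)"
  unfolding corner_rel_def by (rule trans_rtrancl)

lemma gluing_cases:
  assumes "(p, q) \<in> gluing n \<sigma> \<tau>"
  obtains (right) j y where "p = (j, 1, y)" "q = (\<sigma> j, 0, y)" "j \<in> {1..n}" "\<sigma> j \<in> {1..n}" "y \<in> {0..1}"
    | (top) j x where "p = (j, x, 1)" "q = (\<tau> j, x, 0)" "j \<in> {1..n}" "\<tau> j \<in> {1..n}" "x \<in> {0..1}"
  using assms perm_mem unfolding gluing_def by blast

lemma gluing_subset_squares: "gluing n \<sigma> \<tau> \<subseteq> squares n \<times> squares n"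
proof (rule subrelI)
  fix p q assume "(p, q) \<in> gluing n \<sigma> \<tau>"
  thus "(p, q) \<in> squares n \<times> squares n"
    by (cases rule: gluing_cases) (simp_all add: squares_def)
qed

text \<open>The orbit of the base square is an invariant of the gluing: the choice made for the top right
  corners is only ambiguous up to the commutator.\<close>

lemma gluing_preserves_base_orbit:
  assumes "(p, q) \<in> gluing n \<sigma> \<tau>"
  shows "p \<in> square_corners n \<longleftrightarrow> q \<in> square_corners n"
    and "p \<in> square_corners n \<Longrightarrow>
      orbit (perm_commutator \<sigma> \<tau>) (base_square \<sigma> \<tau> p) =
      orbit (perm_commutator \<sigma> \<tau>) (base_square \<sigma> \<tau> q)"
proof -
  have orb: "orbit (perm_commutator \<sigma> \<tau>) (\<sigma> (\<tau> j)) = orbit (perm_commutator \<sigma> \<tau>) (\<tau> (\<sigma> j))" for j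
    using permutation_orbit_step[OF permutation_commutator, of "\<tau> (\<sigma> j)"]
    by (simp add: commutator_apply)
  show "p \<in> square_corners n \<longleftrightarrow> q \<in> square_corners n"
    using assms by (cases rule: gluing_cases) (simp_all add: square_corners_def)
  show "orbit (perm_commutator \<sigma> \<tau>) (base_square \<sigma> \<tau> p) =
      orbit (perm_commutator \<sigma> \<tau>) (base_square \<sigma> \<tau> q)" if "p \<in> square_corners n"
    using assms
  proof (cases rule: gluing_cases)
    case (right j y)
    thus ?thesis using that by (auto simp: square_corners_def base_square_def orb)
  next
    case (top j x)
    thus ?thesis using that by (auto simp: square_corners_def base_square_def orb)
  qed
qed

lemma corner_rel_preserves_base_orbit:
  assumes "(p, q) \<in> corner_rel n \<sigma> \<tau>" "p \<in> square_corners n"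
  shows "q \<in> square_corners n \<and>
      orbit (perm_commutator \<sigma> \<tau>) (base_square \<sigma> \<tau> q) =
      orbit (perm_commutator \<sigma> \<tau>) (base_square \<sigma> \<tau> p)"
  using assms unfolding corner_rel_def
proof (induction rule: rtrancl_induct)
  case (step q r)
  thus ?case
    using gluing_preserves_base_orbit[of q r] gluing_preserves_base_orbit[of r q] by auto
qed simp

lemma gluing_in_corner_rel:
  assumes "j \<in> {1..n}" "x \<in> {0..1}"
  shows "((j, 1, x), (\<sigma> j, 0, x)) \<in> corner_rel n \<sigma> \<tau>"
    "((j, x, 1), (\<tau> j, x, 0)) \<in> corner_rel n \<sigma> \<tau>"
  using assms unfolding corner_rel_def gluing_def by (blast intro: r_into_rtrancl)+

lemma corner_rel_base_square:
  assumes "p \<in> square_corners n"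
  shows "(p, (base_square \<sigma> \<tau> p, 0, 0)) \<in> corner_rel n \<sigma> \<tau>"
proof -
  obtain j x y where p: "p = (j, x, y)" and j: "j \<in> {1..n}" and x: "x \<in> {0, 1}" and y: "y \<in> {0, 1}"
    using assms unfolding square_corners_def by auto
  define i where "i = (if y = 1 then \<tau> else id) j"
  have i: "i \<in> {1..n}" using j perm_mem by (auto simp: i_def)
  have refl: "(q, q) \<in> corner_rel n \<sigma> \<tau>" for q by (simp add: corner_rel_def)
  have "(p, (i, x, 0)) \<in> corner_rel n \<sigma> \<tau>"
    using gluing_in_corner_rel(2)[OF j, of x] x y refl by (auto simp: p i_def)
  moreover have "((i, x, 0), ((if x = 1 then \<sigma> else id) i, 0, 0)) \<in> corner_rel n \<sigma> \<tau>"
    using gluing_in_corner_rel(1)[OF i, of 0] x refl by auto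
  ultimately show ?thesis
    using trans_corner_rel unfolding p base_square_def i_def by (auto dest: transD)
qed

text \<open>Conversely, the two ways from a top right corner to a bottom left corner show that the commutator
  does not leave the vertex.\<close>

lemma corner_rel_commutator:
  assumes "j \<in> {1..n}"
  shows "((j, 0, 0), (perm_commutator \<sigma> \<tau> j, 0, 0)) \<in> corner_rel n \<sigma> \<tau>"
proof -
  obtain i where i: "i \<in> {1..n}" "j = \<tau> (\<sigma> i)"
    using assms permutes_image[OF \<sigma>] permutes_image[OF \<tau>] by (metis imageE)
  have "((i, 1, 1), (\<sigma> i, 0, 1)) \<in> corner_rel n \<sigma> \<tau>" "((\<sigma> i, 0, 1), (j, 0, 0)) \<in> corner_rel n \<sigma> \<tau>"
    using gluing_in_corner_rel(1)[OF i(1), of 1] gluing_in_corner_rel(2)[OF perm_mem(1)[OF i(1)], of 0]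
    by (simp_all add: i(2))
  hence "((i, 1, 1), (j, 0, 0)) \<in> corner_rel n \<sigma> \<tau>" using trans_corner_rel by (blast dest: transD)
  moreover have "((i, 1, 1), (\<sigma> (\<tau> i), 0, 0)) \<in> corner_rel n \<sigma> \<tau>"
    using corner_rel_base_square[of "(i, 1, 1)"] i(1) by (simp add: square_corners_def base_square_def)
  ultimately show ?thesis
    using trans_corner_rel sym_corner_rel unfolding i(2) commutator_apply
    by (meson symD transD)
qed

lemma corner_rel_orbit:
  assumes "i \<in> orbit (perm_commutator \<sigma> \<tau>) j" "j \<in> {1..n}"
  shows "((j, 0, 0), (i, 0, 0)) \<in> corner_rel n \<sigma> \<tau>"
  using assms
proof (induction rule: orbit.induct)
  case base
  thus ?case by (rule corner_rel_commutator)
next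
  case (step i)
  have "i \<in> {1..n}" using step permutes_orbit_subset[OF commutator_permutes] by blast
  thus ?case using step corner_rel_commutator[of i] trans_corner_rel by (blast dest: transD)
qed

lemma base_square_mem: "p \<in> square_corners n \<Longrightarrow> base_square \<sigma> \<tau> p \<in> {1..n}"
  using perm_mem unfolding base_square_def square_corners_def
  by (cases p) (simp del: atLeastAtMost_iff)

lemma vertex_eq_vertex_of:
  assumes p: "p \<in> square_corners n"
  shows "corner_rel n \<sigma> \<tau> `` {p} =
    vertex_of n \<sigma> \<tau> (orbit (perm_commutator \<sigma> \<tau>) (base_square \<sigma> \<tau> p))"
proof (intro equalityI subsetI)
  fix q assume "q \<in> corner_rel n \<sigma> \<tau> `` {p}"
  thus "q \<in> vertex_of n \<sigma> \<tau> (orbit (perm_commutator \<sigma> \<tau>) (base_square \<sigma> \<tau> p))"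
    using corner_rel_preserves_base_orbit[OF _ p, of q] orbit_eq_iff[OF permutation_commutator]
    by (auto simp: vertex_of_def)
next
  fix q assume "q \<in> vertex_of n \<sigma> \<tau> (orbit (perm_commutator \<sigma> \<tau>) (base_square \<sigma> \<tau> p))"
  hence q: "q \<in> square_corners n"
    and "((base_square \<sigma> \<tau> p, 0, 0), (base_square \<sigma> \<tau> q, 0, 0)) \<in> corner_rel n \<sigma> \<tau>"
    using corner_rel_orbit base_square_mem[OF p] by (auto simp: vertex_of_def)
  hence "(p, q) \<in> corner_rel n \<sigma> \<tau>"
    using corner_rel_base_square[OF p] corner_rel_base_square[OF q] trans_corner_rel sym_corner_rel
    by (meson symD transD)
  thus "q \<in> corner_rel n \<sigma> \<tau> `` {p}" by simp
qed

lemma vertices_eq: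
  "vertices (square_tiled_surface n \<sigma> \<tau>) =
    vertex_of n \<sigma> \<tau> ` orbit (perm_commutator \<sigma> \<tau>) ` {1..n}"
proof (intro equalityI subsetI)
  fix v assume "v \<in> vertices (square_tiled_surface n \<sigma> \<tau>)"
  hence v: "v \<in> squares n // corner_rel n \<sigma> \<tau>" "v \<inter> corners \<noteq> {}"
    unfolding vertices_def square_tiled_surface_def corner_rel_def by blast+
  from v(1) obtain p where p: "p \<in> squares n" "v = corner_rel n \<sigma> \<tau> `` {p}"
    by (rule quotientE)
  from v(2) obtain q where q: "q \<in> v" "q \<in> corners" by blast
  have pq: "(p, q) \<in> corner_rel n \<sigma> \<tau>" using p q by simp
  have "q \<in> squares n"
    using pq p(1) unfolding corner_rel_def
  proof (induction rule: rtrancl_induct)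
    case (step q r)
    thus ?case using gluing_subset_squares by blast
  qed
  hence qc: "q \<in> square_corners n" using q(2) by (auto simp: squares_def square_corners_def corners_def)
  have "v = corner_rel n \<sigma> \<tau> `` {q}"
    using pq p(2) trans_corner_rel sym_corner_rel by (auto dest: symD transD)
  thus "v \<in> vertex_of n \<sigma> \<tau> ` orbit (perm_commutator \<sigma> \<tau>) ` {1..n}"
    using vertex_eq_vertex_of[OF qc] base_square_mem[OF qc] by auto
next
  fix v assume "v \<in> vertex_of n \<sigma> \<tau> ` orbit (perm_commutator \<sigma> \<tau>) ` {1..n}"
  then obtain j where j: "j \<in> {1..n}" "v = vertex_of n \<sigma> \<tau> (orbit (perm_commutator \<sigma> \<tau>) j)" by auto
  have jc: "(j, 0, 0) \<in> square_corners n" using j by (simp add: square_corners_def)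
  have "v = corner_rel n \<sigma> \<tau> `` {(j, 0, 0)}"
    using vertex_eq_vertex_of[OF jc] j by (simp add: base_square_def)
  moreover have "(j, 0, 0) \<in> squares n" using j by (simp add: squares_def)
  moreover have "(j, 0, 0) \<in> v \<inter> corners"
    using jc j permutation_self_in_orbit[OF permutation_commutator, of j]
    by (auto simp: vertex_of_def base_square_def corners_def)
  ultimately show "v \<in> vertices (square_tiled_surface n \<sigma> \<tau>)"
    unfolding vertices_def square_tiled_surface_def corner_rel_def by (auto intro: quotientI)
qed

lemma inj_on_vertex_of: "inj_on (vertex_of n \<sigma> \<tau>) (Pow {1..n})"
proof (rule inj_onI)
  fix A B assume A: "A \<in> Pow {1..n}" and B: "B \<in> Pow {1..n}"
    and eq: "vertex_of n \<sigma> \<tau> A = vertex_of n \<sigma> \<tau> B"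
  have "j \<in> C \<longleftrightarrow> (j, 0, 0) \<in> vertex_of n \<sigma> \<tau> C" if "C \<subseteq> {1..n}" for j C
    using that by (auto simp: vertex_of_def square_corners_def base_square_def)
  hence "j \<in> A \<longleftrightarrow> j \<in> B" for j using A B eq by simp
  thus "A = B" by blast
qed

text \<open>Each of the four corner positions contributes one corner for every element of \<open>A\<close>, because the
  base square depends bijectively on the square when the position is fixed.\<close>

lemma total_angle_vertex_of:
  assumes A: "A \<subseteq> {1..n}"
  shows "total_angle (vertex_of n \<sigma> \<tau> A) = 2 * pi * real (card A)"
proof -
  have card_pre: "card {j \<in> {1..n}. \<pi> j \<in> A} = card A" if "\<pi> permutes {1..n}" for \<pi>
  proof (rule bij_betw_same_card)
    show "bij_betw \<pi> {j \<in> {1..n}. \<pi> j \<in> A} A"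
      unfolding bij_betw_def
    proof
      show "inj_on \<pi> {j \<in> {1..n}. \<pi> j \<in> A}" using permutes_inj_on[OF that] by blast
      have "a \<in> \<pi> ` {j \<in> {1..n}. \<pi> j \<in> A}" if "a \<in> A" for a
      proof -
        from that A have "a \<in> \<pi> ` {1..n}" unfolding permutes_image[OF \<open>\<pi> permutes {1..n}\<close>] ..
        thus ?thesis using that by auto
      qed
      thus "\<pi> ` {j \<in> {1..n}. \<pi> j \<in> A} = A" by blast
    qed
  qed
  let ?b = "\<lambda>x y j. base_square \<sigma> \<tau> (j, x, y)"
  have perm: "?b x y permutes {1..n}" for x y
  proof -
    have "?b x y = (if x = 1 then \<sigma> else id) \<circ> (if y = 1 then \<tau> else id)"
      by (auto simp: base_square_def fun_eq_iff)
    moreover have "\<dots> permutes {1..n}"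
      using \<sigma> \<tau> by (intro permutes_compose) (auto simp: permutes_id)
    ultimately show ?thesis by simp
  qed
  have "vertex_of n \<sigma> \<tau> A =
      (\<lambda>((x, y), j). (j, x, y)) ` (SIGMA (x, y):{0, 1} \<times> {0, 1}. {j \<in> {1..n}. ?b x y j \<in> A})"
    by (auto simp: vertex_of_def square_corners_def image_iff)
  also have "card \<dots> = card (SIGMA (x, y):{0, 1 :: real} \<times> {0, 1 :: real}. {j \<in> {1..n}. ?b x y j \<in> A})"
    by (rule card_image) (auto simp: inj_on_def)
  also have "\<dots> = (\<Sum>(x, y)\<in>{0, 1 :: real} \<times> {0, 1 :: real}. card {j \<in> {1..n}. ?b x y j \<in> A})"
    by (subst card_SigmaI) (auto simp: case_prod_unfold)
  also have "\<dots> = 4 * card A"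
    using card_pre[OF perm] by (simp add: card_cartesian_product)
  finally have "card (vertex_of n \<sigma> \<tau> A) = 4 * card A" .
  moreover have "vertex_of n \<sigma> \<tau> A \<inter> corners = vertex_of n \<sigma> \<tau> A"
    by (auto simp: vertex_of_def square_corners_def corners_def)
  ultimately show ?thesis by (simp add: total_angle_def)
qed

lemma cone_angles_eq:
  "image_mset total_angle (mset_set (cone_points (square_tiled_surface n \<sigma> \<tau>))) =
    image_mset (\<lambda>l. 2 * pi * real l) (cone_type {1..n} (perm_commutator \<sigma> \<tau>))"
proof -
  let ?c = "perm_commutator \<sigma> \<tau>"
  let ?Os = "{A \<in> orbit ?c ` {1..n}. 1 < card A}"
  have sub: "A \<subseteq> {1..n}" if "A \<in> orbit ?c ` {1..n}" for A
    using that permutes_orbit_subset[OF commutator_permutes] by blast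
  have "cone_points (square_tiled_surface n \<sigma> \<tau>) = vertex_of n \<sigma> \<tau> ` ?Os"
    unfolding cone_points_def vertices_eq using total_angle_vertex_of[OF sub] by auto
  moreover have "inj_on (vertex_of n \<sigma> \<tau>) ?Os"
    by (rule inj_on_subset[OF inj_on_vertex_of]) (use sub in blast)
  ultimately have "mset_set (cone_points (square_tiled_surface n \<sigma> \<tau>)) =
      image_mset (vertex_of n \<sigma> \<tau>) (mset_set ?Os)"
    by (simp add: image_mset_mset_set)
  hence "image_mset total_angle (mset_set (cone_points (square_tiled_surface n \<sigma> \<tau>))) =
      image_mset (\<lambda>A. total_angle (vertex_of n \<sigma> \<tau> A)) (mset_set ?Os)"
    by (simp add: multiset.map_comp o_def)
  also have "\<dots> = image_mset (\<lambda>A. 2 * pi * real (card A)) (mset_set ?Os)"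
    using sub by (intro image_mset_cong total_angle_vertex_of) auto
  also have "\<dots> = image_mset (\<lambda>l. 2 * pi * real l) (cone_type {1..n} ?c)"
    unfolding cone_type_def cycle_type_def
    by (simp add: filter_mset_image_mset multiset.map_comp o_def)
  finally show ?thesis .
qed

lemma mem_stratum_iff:
  assumes "1 \<le> n"
  shows "square_tiled_surface n \<sigma> \<tau> \<in> stratum A \<longleftrightarrow>
    cone_type {1..n} (perm_commutator \<sigma> \<tau>) = image_mset Suc A"
proof -
  have "square_tiled_surface n \<sigma> \<tau> \<in> square_tiled_surfaces"
    unfolding square_tiled_surfaces_def using assms \<sigma> \<tau> by blast
  moreover have "image_mset (\<lambda>a. 2 * pi * (real a + 1)) A =
      image_mset (\<lambda>l. 2 * pi * real l) (image_mset Suc A)"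
    by (simp add: multiset.map_comp o_def add.commute)
  moreover have "inj (image_mset (\<lambda>l :: nat. 2 * pi * real l))"
    by (rule multiset.inj_map) (auto simp: inj_on_def)
  ultimately show ?thesis
    by (simp add: stratum_def cone_angles_eq inj_eq)
qed

end

section \<open>Probabilities of strata\<close>

text \<open>The Cauchy-Schwarz inequality is applied to the sum over \<open>T\<close>, not over \<open>A\<close>. This gains the factor
  \<open>|T| / |A|\<close> under the root, which makes the error for a small event small as well.\<close>

lemma abs_sum_minus_uniform_le:
  fixes p :: "'a \<Rightarrow> real"
  assumes A: "finite A" "A \<noteq> {}" and T: "T \<subseteq> A"
  shows "\<bar>sum p T - card T / card A\<bar> \<le>
    sqrt (card T / card A * (card A * (\<Sum>x\<in>A. \<bar>p x - 1 / card A\<bar>\<^sup>2)))"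
proof -
  define d where "d = (\<lambda>x. p x - 1 / card A)"
  have "sum p T - card T / card A = sum d T" by (simp add: d_def sum_subtractf)
  moreover have "(sum d T)\<^sup>2 \<le> card T * (\<Sum>x\<in>T. (d x)\<^sup>2)"
    using sum_squared_le_sum_of_squares[of d T] finite_subset[OF T A(1)]
    by (simp add: mult.commute)
  moreover have "\<dots> \<le> card T * (\<Sum>x\<in>A. (d x)\<^sup>2)"
    using A(1) T by (intro mult_left_mono sum_mono2) auto
  moreover have "\<dots> = card T / card A * (card A * (\<Sum>x\<in>A. (d x)\<^sup>2))"
    using A by simp
  ultimately have "(sum p T - card T / card A)\<^sup>2 \<le>
      card T / card A * (card A * (\<Sum>x\<in>A. (d x)\<^sup>2))" by simp
  from real_sqrt_le_mono[OF this] show ?thesis by (simp add: d_def)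
qed

lemma evenperm_commutator:
  assumes "permutation \<sigma>" "permutation \<tau>"
  shows "evenperm (perm_commutator \<sigma> \<tau>)"
  using assms unfolding perm_commutator_def
  by (simp add: evenperm_comp evenperm_inv permutation_compose permutation_inverse del: o_apply)
     blast

definition even_perms_in_stratum :: "nat \<Rightarrow> nat multiset \<Rightarrow> (nat \<Rightarrow> nat) set" where
  "even_perms_in_stratum n B =
    {c \<in> carrier (alt_group n). cone_type {1..n} c = image_mset Suc B}"

lemma finite_alt_group: "finite (carrier (alt_group n))"
  by (rule finite_subset[OF _ finite_permutations[of "{1..n}"]]) (auto simp: alt_group_carrier)

text \<open>Commutators are even, so restricting to even permutations loses no part of the stratum.\<close>

lemma stratum_prob_eq:
  assumes n: "1 \<le> n"
    and support: "set_pmf D \<subseteq> carrier (sym_group n) \<times> carrier (sym_group n)"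
  shows "stratum_prob n D B = sum (pmf (commutator_pmf D)) (even_perms_in_stratum n B)"
proof -
  let ?f = "\<lambda>(\<sigma>, \<tau>). perm_commutator \<sigma> \<tau>"
  let ?T = "even_perms_in_stratum n B"
  have "{(\<sigma>, \<tau>). square_tiled_surface n \<sigma> \<tau> \<in> stratum B} \<inter> set_pmf D = ?f -` ?T \<inter> set_pmf D"
  proof -
    have "square_tiled_surface n \<sigma> \<tau> \<in> stratum B \<longleftrightarrow> perm_commutator \<sigma> \<tau> \<in> ?T"
      if "(\<sigma>, \<tau>) \<in> set_pmf D" for \<sigma> \<tau>
    proof -
      have \<sigma>: "\<sigma> permutes {1..n}" and \<tau>: "\<tau> permutes {1..n}"
        using that support by (auto simp: sym_group_carrier)
      hence "permutation \<sigma>" "permutation \<tau>" using permutation_permutes by blast+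
      thus ?thesis
        using mem_stratum_iff[OF \<sigma> \<tau> n] commutator_permutes[OF \<sigma> \<tau>] evenperm_commutator
        by (simp add: even_perms_in_stratum_def alt_group_carrier)
    qed
    thus ?thesis by auto
  qed
  hence "stratum_prob n D B = measure_pmf.prob D (?f -` ?T)"
    unfolding stratum_prob_def by (metis measure_Int_set_pmf)
  also have "\<dots> = measure_pmf.prob (commutator_pmf D) ?T"
    by (simp add: commutator_pmf_def)
  also have "\<dots> = sum (pmf (commutator_pmf D)) ?T"
    by (rule measure_measure_pmf_finite)
       (auto intro: finite_subset[OF _ finite_alt_group[of n]] simp: even_perms_in_stratum_def)
  finally show ?thesis .
qed

lemma fact_le_card_even_perms_one_cone:
  assumes n: "3 \<le> n" and l: "l \<in> {n - 1, n}" "odd l"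
  shows "fact (n - 1) \<le> card (even_perms_in_stratum n {#l - 1#})"
proof -
  have "{c. c permutes {1..n} \<and> cone_type {1..n} c = {#l#}} = even_perms_in_stratum n {#l - 1#}"
    using n l evenperm_if_single_cone[of "{1..n}" _ l]
    by (auto simp: even_perms_in_stratum_def alt_group_carrier)
  moreover have "fact n \<le> n * card {c. c permutes {1..n} \<and> cone_type {1..n} c = {#l#}}"
    using card_long_cycles_ge[of "{1..n}" l] n l by auto
  moreover have "(fact n :: nat) = n * fact (n - 1)" using n by (simp add: fact_reduce)
  ultimately show ?thesis using n by simp
qed

text \<open>A single cone point of angle \<open>2 \<pi> n\<close> or \<open>2 \<pi> (n - 1)\<close> forces the commutator to be a cycle of that length, and
  evenness leaves only the odd length \<open>l\<close>. All other cone types fall under the general bound.\<close>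

lemma card_even_perms_other_le:
  assumes n: "12 \<le> n" and l: "l \<in> {n - 1, n}" "odd l" and B: "B \<noteq> {#l - 1#}"
  shows "card (even_perms_in_stratum n B) * (3 * n) \<le> 2 * fact n"
proof (cases "image_mset Suc B = {#n#} \<or> image_mset Suc B = {#n - 1#}")
  case True
  then obtain l' where l': "l' \<in> {n - 1, n}" "image_mset Suc B = {#l'#}" by auto
  have "even_perms_in_stratum n B = {}"
  proof (rule ccontr)
    assume "even_perms_in_stratum n B \<noteq> {}"
    then obtain c where "c permutes {1..n}" "evenperm c" "cone_type {1..n} c = {#l'#}"
      by (auto simp: even_perms_in_stratum_def alt_group_carrier l'(2))
    hence "odd l'" using evenperm_if_single_cone[of "{1..n}" c l'] by simp
    hence "l' = l" using l l'(1) n by auto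
    hence "image_mset Suc B = image_mset Suc {#l - 1#}" using l'(2) l(2) by (auto elim: oddE)
    hence "B = {#l - 1#}" using multiset.inj_map[OF inj_Suc] by (simp only: inj_eq)
    with B show False ..
  qed
  thus ?thesis by simp
next
  case False
  have "card (even_perms_in_stratum n B)
      \<le> card {c. c permutes {1..n} \<and> cone_type {1..n} c = image_mset Suc B}"
    by (intro card_mono finite_subset[OF _ finite_permutations[of "{1..n}"]])
       (auto simp: even_perms_in_stratum_def alt_group_carrier)
  hence "card (even_perms_in_stratum n B) * (3 * n)
      \<le> card {c. c permutes {1..n} \<and> cone_type {1..n} c = image_mset Suc B} * (3 * n)"
    by (rule mult_le_mono1)
  also have "\<dots> \<le> 2 * fact n"
    using card_other_cone_types_le[of "{1..n}" "image_mset Suc B"] n False by simp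
  finally show ?thesis .
qed

text \<open>The hypotheses give \<open>T\<close> and \<open>T'\<close> the uniform probabilities at least \<open>2 / n\<close> and at most
  \<open>4 / (3 n)\<close>. The divisibility allows to cut \<open>T\<close> down to uniform probability exactly \<open>2 / n\<close>, so that
  both errors are at most \<open>e = sqrt (2 E / n)\<close>. The bound on \<open>n E\<close> says that twice this error is less
  than the gap \<open>2 / (3 n)\<close>.\<close>

lemma sum_less_sum_if_close_to_uniform:
  fixes p :: "'a \<Rightarrow> real"
  assumes A: "finite A" "A \<noteq> {}" "T \<subseteq> A" "T' \<subseteq> A" and p: "\<And>x. 0 \<le> p x"
    and n: "0 < n"
    and T: "2 * card A \<le> n * card T" and T': "3 * n * card T' \<le> 4 * card A"
    and E: "E = card A * (\<Sum>x\<in>A. \<bar>p x - 1 / card A\<bar>\<^sup>2)" "18 * (real n * E) < 1"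
    and dvd: "n dvd 2 * card A"
  shows "sum p T' < sum p T"
proof -
  have cA: "0 < card A" using A by (simp add: card_gt_0_iff)
  have E0: "0 \<le> E" unfolding E(1) by (intro mult_nonneg_nonneg sum_nonneg) auto
  define e where "e = sqrt (2 / n * E)"
  have "3 * n * e < 1"
  proof -
    have "(3 * n * e)\<^sup>2 = 18 * (real n * E)"
      using n E0 by (simp add: e_def power_mult_distrib power2_eq_square)
    hence "(3 * n * e)\<^sup>2 < 1\<^sup>2" using E(2) by simp
    thus ?thesis by (rule power2_less_imp_less) simp
  qed
  hence e: "2 * e < 2 / (3 * n)" using n by (simp add: field_simps)
  obtain m where m: "2 * card A = n * m" using dvd by (auto elim: dvdE)
  have "m \<le> card T" using T m n by simp
  then obtain U where U: "U \<subseteq> T" "card U = m" by (metis obtain_subset_with_card_n)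
  have ratio: "real (card U) / card A = 2 / n"
    using arg_cong[OF m, of real] n cA U(2) by (simp add: field_simps)
  have close: "\<bar>sum p V - card V / card A\<bar> \<le> sqrt (card V / card A * E)" if "V \<subseteq> A" for V
    unfolding E(1) by (rule abs_sum_minus_uniform_le[OF A(1,2) that])
  have "\<bar>sum p U - card U / card A\<bar> \<le> e"
    using close[of U] U(1) A(3) unfolding ratio e_def by blast
  hence lower: "2 / n - e \<le> sum p U" unfolding ratio by linarith
  have "sum p U \<le> sum p T"
    using U(1) A(1,3) p by (intro sum_mono2) (auto intro: finite_subset)
  have ratio': "real (card T') / card A \<le> 4 / (3 * n)"
    using of_nat_mono[OF T', where 'a = real] n cA by (simp add: field_simps)
  also have "4 / (3 * n) \<le> 2 / real n" using n by (simp add: field_simps)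
  finally have "real (card T') / card A \<le> 2 / n" .
  hence "sqrt (card T' / card A * E) \<le> e"
    unfolding e_def using E0 by (intro real_sqrt_le_mono mult_right_mono)
  moreover have "\<bar>sum p T' - card T' / card A\<bar> \<le> sqrt (card T' / card A * E)"
    by (rule close[OF A(4)])
  ultimately have "sum p T' \<le> 4 / (3 * n) + e" using ratio' by linarith
  moreover have "4 / (3 * n) + 2 / (3 * n) = 2 / real n" using n by (simp add: field_simps)
  ultimately show ?thesis using e lower \<open>sum p U \<le> sum p T\<close> by linarith
qed

lemma eventually_mult_less_if_bigo_powr:
  fixes E :: "nat \<Rightarrow> real"
  assumes s: "1 < s" and E: "E \<in> O(\<lambda>n. 1 / real n powr s)" and c: "0 < c"
  shows "\<forall>\<^sub>F n in sequentially. real n * E n < c"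
proof -
  obtain K where K: "\<forall>\<^sub>F n in sequentially. norm (E n) \<le> K * norm (1 / real n powr s)"
    using E by (auto elim: landau_o.bigE)
  have "((\<lambda>n. K * real n powr (1 - s)) \<longlongrightarrow> K * 0) sequentially"
    using s by (intro tendsto_intros tendsto_neg_powr filterlim_real_sequentially) auto
  hence "\<forall>\<^sub>F n in sequentially. K * real n powr (1 - s) < c"
    using c by (intro order_tendstoD(2)[where y = "K * 0"]) auto
  with K eventually_gt_at_top[of 0] show ?thesis
  proof eventually_elim
    case (elim n)
    have "real n * E n \<le> real n * (K * (1 / real n powr s))"
      using elim by (intro mult_left_mono) auto
    also have "\<dots> = K * real n powr (1 - s)"
      using elim by (simp add: powr_diff)
    finally show ?case using elim by linarith
  qed
qed

theorem theorem1p5: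
  fixes D :: "nat \<Rightarrow> ((nat \<Rightarrow> nat) \<times> (nat \<Rightarrow> nat)) pmf"
    and s :: real
  assumes support: "\<And>n. n \<ge> 1 \<Longrightarrow>
      set_pmf (D n) \<subseteq> carrier (sym_group n) \<times> carrier (sym_group n)"
    and class_function: "\<And>n \<pi> \<rho>. n \<ge> 1 \<Longrightarrow> \<pi> \<in> carrier (sym_group n) \<Longrightarrow>
      \<rho> \<in> carrier (alt_group n) \<Longrightarrow>
      pmf (commutator_pmf (D n)) (\<pi> \<circ> \<rho> \<circ> inv' \<pi>) = pmf (commutator_pmf (D n)) \<rho>"
    and s: "s > 1"
    and L2_bound: "(\<lambda>n. real (card (carrier (alt_group n))) *
        (\<Sum>\<rho> \<in> carrier (alt_group n).
          \<bar>pmf (commutator_pmf (D n)) \<rho> - pmf (pmf_of_set (carrier (alt_group n))) \<rho>\<bar>\<^sup>2))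
      \<in> O(\<lambda>n. 1 / real n powr s)"
  shows "\<exists>N. \<forall>n>N. most_probable_stratum n (D n) (if odd n then {#n - 1#} else {#n - 2#})"
proof -
  define E where "E = (\<lambda>n. real (card (carrier (alt_group n))) *
    (\<Sum>\<rho> \<in> carrier (alt_group n).
      \<bar>pmf (commutator_pmf (D n)) \<rho> - pmf (pmf_of_set (carrier (alt_group n))) \<rho>\<bar>\<^sup>2))"
  have "E \<in> O(\<lambda>n. 1 / real n powr s)" unfolding E_def by (rule L2_bound)
  from eventually_mult_less_if_bigo_powr[OF s this, of "1 / 18"]
  have "\<forall>\<^sub>F n in sequentially. real n * E n < 1 / 18" by simp
  with eventually_ge_at_top[of 12]
  have "\<forall>\<^sub>F n in sequentially.
    most_probable_stratum n (D n) (if odd n then {#n - 1#} else {#n - 2#})"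
  proof eventually_elim
    case (elim n)
    \<comment> \<open>The cycle length of the claimed stratum, namely the one of \<open>n - 1\<close> and \<open>n\<close> that is odd.\<close>
    define l where "l = (if odd n then n else n - 1)"
    have l: "l \<in> {n - 1, n}" "odd l" using elim by (auto simp: l_def)
    have target: "(if odd n then {#n - 1#} else {#n - 2#}) = {#l - 1#}"
      by (simp add: l_def numeral_2_eq_2)
    let ?A = "carrier (alt_group n)" and ?p = "pmf (commutator_pmf (D n))"
    have A: "finite ?A" "2 * card ?A = fact n"
      using finite_alt_group alt_group_card_carrier elim by auto
    hence ne: "?A \<noteq> {}" by auto
    have fact: "(fact n :: nat) = n * fact (n - 1)" using elim by (simp add: fact_reduce)
    have "stratum_prob n (D n) B < stratum_prob n (D n) {#l - 1#}" if "B \<noteq> {#l - 1#}" for B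
    proof -
      have "sum ?p (even_perms_in_stratum n B) < sum ?p (even_perms_in_stratum n {#l - 1#})"
      proof (rule sum_less_sum_if_close_to_uniform[OF A(1) ne, where n = n and E = "E n"])
        show "2 * card ?A \<le> n * card (even_perms_in_stratum n {#l - 1#})"
          unfolding A(2) fact using fact_le_card_even_perms_one_cone[of n l] elim l by simp
        show "3 * n * card (even_perms_in_stratum n B) \<le> 4 * card ?A"
          using card_even_perms_other_le[OF _ l that] elim A(2) by (simp add: mult.commute)
        show "E n = card ?A * (\<Sum>x\<in>?A. \<bar>?p x - 1 / card ?A\<bar>\<^sup>2)"
          using A(1) ne by (simp add: E_def)
        show "n dvd 2 * card ?A" unfolding A(2) fact by simp
      qed (use elim in \<open>auto simp: even_perms_in_stratum_def\<close>)
      thus ?thesis using stratum_prob_eq[OF _ support] elim by simp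
    qed
    moreover have "0 < l - 1" using elim by (auto simp: l_def)
    ultimately show ?case unfolding most_probable_stratum_def target by simp
  qed
  then obtain N where "\<forall>n\<ge>N. most_probable_stratum n (D n) (if odd n then {#n - 1#} else {#n - 2#})"
    unfolding eventually_sequentially by blast
  thus ?thesis by (meson less_imp_le)
qed

end
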